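(* Let $n,\sigma\in\mathbb{N}$ be positive integers, $\tau\in\mathbb{Z}$, $\Delta>0$, $\alpha_1,\dots,\alpha_n\in\mathbb{C}$, and $\phi_1,\dots,\phi_n\in\mathbb{R}$ with $|\phi_i|\Delta<\pi$ for all $i$. For $s\in\mathbb{Z}$ put $f_s=\sum_{i=1}^n\alpha_i\sin(\phi_i s\Delta)$. Then the $n\times n$ matrix ${}^{\tau}_{\sigma}B_n$ built from these samples (defined in the context) factorizes as $${}^{\tau}_{\sigma}B_n = U_n L_n A_n W_n^T,$$ where $U_n=\big(\sin(\phi_i k\sigma\Delta)\big)_{k=1,\dots,n;\ i=1,\dots,n}$ and $W_n=\big(\cos(\phi_i k\sigma\Delta)\big)_{k=0,\dots,n-1;\ i=1,\dots,n}$ (row index $k$, column index $i$), $A_n=\mathrm{diag}(\alpha_1,\dots,\alpha_n)$ and $L_n=\mathrm{diag}(\cos(\phi_1\tau\Delta),\dots,\cos(\phi_n\tau\Delta))$.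
   Context: For a family $(f_s)_{s\in\mathbb{Z}}$ of complex numbers, $n\ge 1$, and $\sigma,\tau\in\mathbb{Z}$, the Hankel matrix ${}^{\tau}_{\sigma}H_n$ is the $n\times n$ matrix with entry $f_{\tau+(k+\ell)\sigma}$ at position $(k+1,\ell+1)$, and the Toeplitz matrix ${}^{\tau}_{\sigma}T_n$ is the $n\times n$ matrix with entry $f_{\tau+(k-\ell)\sigma}$ at position $(k+1,\ell+1)$, for $k,\ell=0,\dots,n-1$. Then $${}^{\tau}_{\sigma}B_n := \tfrac14\,{}^{\sigma+\tau}_{\sigma}H_n+\tfrac14\,{}^{\sigma-\tau}_{\sigma}H_n+\tfrac14\,{}^{\sigma+\tau}_{\sigma}T_n+\tfrac14\,{}^{\sigma-\tau}_{\sigma}T_n .$$ *)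

theory Defs
  imports Complex_Main "Jordan_Normal_Form.Matrix"
begin

text \<open>
  Matrices are indexed from 0, so the entry in position \<open>(k + 1, l + 1)\<close> of the mathematical
  notation is the entry at \<open>(k, l)\<close> here. A family over the integers is a function on \<^typ>\<open>int\<close>.
\<close>

definition hankel_mat :: "(int \<Rightarrow> complex) \<Rightarrow> int \<Rightarrow> int \<Rightarrow> nat \<Rightarrow> complex mat" where
  "hankel_mat f \<sigma> \<tau> n = mat n n (\<lambda>(k, l). f (\<tau> + (int k + int l) * \<sigma>))"

definition toeplitz_mat :: "(int \<Rightarrow> complex) \<Rightarrow> int \<Rightarrow> int \<Rightarrow> nat \<Rightarrow> complex mat" where
  "toeplitz_mat f \<sigma> \<tau> n = mat n n (\<lambda>(k, l). f (\<tau> + (int k - int l) * \<sigma>))"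

definition B_mat :: "(int \<Rightarrow> complex) \<Rightarrow> int \<Rightarrow> int \<Rightarrow> nat \<Rightarrow> complex mat" where
  "B_mat f \<sigma> \<tau> n =
     (1/4) \<cdot>\<^sub>m hankel_mat f \<sigma> (\<sigma> + \<tau>) n + (1/4) \<cdot>\<^sub>m hankel_mat f \<sigma> (\<sigma> - \<tau>) n
   + (1/4) \<cdot>\<^sub>m toeplitz_mat f \<sigma> (\<sigma> + \<tau>) n + (1/4) \<cdot>\<^sub>m toeplitz_mat f \<sigma> (\<sigma> - \<tau>) n"

text \<open>
  The parameters \<open>\<phi>\<close> and \<open>\<alpha>\<close> below are numbered \<open>1, \<dots>, n\<close>, so column \<open>i\<close> belongs to
  \<open>\<phi> (Suc i)\<close>. The rows of \<open>U_mat\<close> correspond to \<open>k = 1, \<dots>, n\<close>, hence the row shift, whereas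
  those of \<open>W_mat\<close> correspond to \<open>k = 0, \<dots>, n - 1\<close>.
\<close>

definition sine_samples :: "nat \<Rightarrow> (nat \<Rightarrow> complex) \<Rightarrow> (nat \<Rightarrow> real) \<Rightarrow> real \<Rightarrow> int \<Rightarrow> complex" where
  "sine_samples n \<alpha> \<phi> \<Delta> s = (\<Sum>i = 1..n. \<alpha> i * complex_of_real (sin (\<phi> i * of_int s * \<Delta>)))"

definition U_mat :: "(nat \<Rightarrow> real) \<Rightarrow> real \<Rightarrow> int \<Rightarrow> nat \<Rightarrow> complex mat" where
  "U_mat \<phi> \<Delta> \<sigma> n =
     mat n n (\<lambda>(k, i). complex_of_real (sin (\<phi> (Suc i) * real (Suc k) * of_int \<sigma> * \<Delta>)))"

definition W_mat :: "(nat \<Rightarrow> real) \<Rightarrow> real \<Rightarrow> int \<Rightarrow> nat \<Rightarrow> complex mat" where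
  "W_mat \<phi> \<Delta> \<sigma> n =
     mat n n (\<lambda>(k, i). complex_of_real (cos (\<phi> (Suc i) * real k * of_int \<sigma> * \<Delta>)))"

definition A_mat :: "(nat \<Rightarrow> complex) \<Rightarrow> nat \<Rightarrow> complex mat" where
  "A_mat \<alpha> n = mat_diag n (\<lambda>i. \<alpha> (Suc i))"

definition L_mat :: "(nat \<Rightarrow> real) \<Rightarrow> real \<Rightarrow> int \<Rightarrow> nat \<Rightarrow> complex mat" where
  "L_mat \<phi> \<Delta> \<tau> n = mat_diag n (\<lambda>i. complex_of_real (cos (\<phi> (Suc i) * of_int \<tau> * \<Delta>)))"

end

theory Submission
  imports Defs
begin

text \<open>
  Product-to-sum: \<open>4 sin a cos b cos t\<close> is the sum of \<open>sin (a \<plusminus> b \<plusminus> t)\<close> over the four choices of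
  signs. With \<open>a = (k + 1) \<sigma>\<close>, \<open>b = l \<sigma>\<close>, \<open>t = \<tau>\<close> (each times \<open>\<phi>\<^sub>i \<Delta>\<close>), the signs of \<open>b\<close> separate the
  Hankel from the Toeplitz part and those of \<open>t\<close> the shifts \<open>\<sigma> + \<tau>\<close> and \<open>\<sigma> - \<tau>\<close>.
\<close>

lemma sin_plus_minus_sum:
  fixes a b t :: real
  shows "sin (a + b + t) + sin (a + b - t) + sin (a - b + t) + sin (a - b - t)
    = 4 * (sin a * cos t * cos b)"
  by (simp add: sin_add sin_diff cos_add cos_diff algebra_simps)

text \<open>Samples are sums over the frequencies, so product-to-sum applies to each frequency
  separately. The factors on the right follow the order sine, \<open>L_mat\<close>,
  \<open>A_mat\<close>, cosine of the matrix product.\<close>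

lemma sine_samples_four_term:
  fixes a b t :: int
  shows "(sine_samples n \<alpha> \<phi> \<Delta> (a + b + t) + sine_samples n \<alpha> \<phi> \<Delta> (a + b - t)
      + sine_samples n \<alpha> \<phi> \<Delta> (a - b + t) + sine_samples n \<alpha> \<phi> \<Delta> (a - b - t)) / 4
    = (\<Sum>i<n. complex_of_real (sin (\<phi> (Suc i) * of_int a * \<Delta>))
        * complex_of_real (cos (\<phi> (Suc i) * of_int t * \<Delta>)) * \<alpha> (Suc i)
        * complex_of_real (cos (\<phi> (Suc i) * of_int b * \<Delta>)))"
proof -
  \<comment> \<open>Shifting the summation index to start at 0 makes it agree with the matrix column
    index.\<close>
  have samples: "sine_samples n \<alpha> \<phi> \<Delta> s
      = (\<Sum>i<n. \<alpha> (Suc i) * complex_of_real (sin (\<phi> (Suc i) * of_int s * \<Delta>)))" for s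
    unfolding sine_samples_def by (simp add: sum.atLeast1_atMost_eq)
  have "(\<alpha> j * complex_of_real (sin (\<phi> j * of_int (a + b + t) * \<Delta>))
      + \<alpha> j * complex_of_real (sin (\<phi> j * of_int (a + b - t) * \<Delta>))
      + \<alpha> j * complex_of_real (sin (\<phi> j * of_int (a - b + t) * \<Delta>))
      + \<alpha> j * complex_of_real (sin (\<phi> j * of_int (a - b - t) * \<Delta>))) / 4
    = complex_of_real (sin (\<phi> j * of_int a * \<Delta>)) * complex_of_real (cos (\<phi> j * of_int t * \<Delta>))
      * \<alpha> j * complex_of_real (cos (\<phi> j * of_int b * \<Delta>))" (is "?lhs = ?rhs") for j
  proof -
    let ?w = "\<lambda>s::int. \<phi> j * of_int s * \<Delta>"
    have "?lhs = \<alpha> j * complex_of_real (sin (?w a + ?w b + ?w t) + sin (?w a + ?w b - ?w t)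
        + sin (?w a - ?w b + ?w t) + sin (?w a - ?w b - ?w t)) / 4"
      by (simp add: ring_distribs)
    also have "\<dots> = ?rhs"
      unfolding sin_plus_minus_sum by simp
    finally show ?thesis .
  qed
  then show ?thesis
    unfolding samples by (simp flip: sum.distrib add: sum_divide_distrib)
qed

theorem theorem2:
  fixes n \<sigma> :: nat and \<tau> :: int and \<Delta> :: real
    and \<alpha> :: "nat \<Rightarrow> complex" and \<phi> :: "nat \<Rightarrow> real"
  assumes "n > 0" and "\<sigma> > 0" and "\<Delta> > 0"
    and "\<And>i. i \<in> {1..n} \<Longrightarrow> \<bar>\<phi> i\<bar> * \<Delta> < pi"
  shows "B_mat (sine_samples n \<alpha> \<phi> \<Delta>) (int \<sigma>) \<tau> n =
         U_mat \<phi> \<Delta> (int \<sigma>) n * L_mat \<phi> \<Delta> \<tau> n * A_mat \<alpha> n * transpose_mat (W_mat \<phi> \<Delta> (int \<sigma>) n)"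
proof -
  let ?f = "sine_samples n \<alpha> \<phi> \<Delta>"
  have "B_mat ?f (int \<sigma>) \<tau> n $$ (k, l)
      = (U_mat \<phi> \<Delta> (int \<sigma>) n * L_mat \<phi> \<Delta> \<tau> n * A_mat \<alpha> n
          * transpose_mat (W_mat \<phi> \<Delta> (int \<sigma>) n)) $$ (k, l)"
    if kl: "k < n" "l < n" for k l
  proof -
    \<comment> \<open>The \<sigma> in the shifts \<sigma> + \<tau> and \<sigma> - \<tau> is absorbed
      into the row: \<sigma> + (k + l) \<sigma> = (k + 1) \<sigma> + l \<sigma>, and likewise with -
      l. Hence the rows of \<open>U_mat\<close> start at 1 and those of \<open>W_mat\<close> at
      0.\<close>
    let ?a = "int (Suc k) * int \<sigma>" and ?b = "int l * int \<sigma>"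
    have "B_mat ?f (int \<sigma>) \<tau> n $$ (k, l)
        = (?f (?a + ?b + \<tau>) + ?f (?a + ?b - \<tau>) + ?f (?a - ?b + \<tau>) + ?f (?a - ?b - \<tau>)) / 4"
      using kl by (simp add: B_mat_def hankel_mat_def toeplitz_mat_def algebra_simps add_divide_distrib)
    also have "\<dots> = (\<Sum>i<n. complex_of_real (sin (\<phi> (Suc i) * of_int ?a * \<Delta>))
        * complex_of_real (cos (\<phi> (Suc i) * of_int \<tau> * \<Delta>)) * \<alpha> (Suc i)
        * complex_of_real (cos (\<phi> (Suc i) * of_int ?b * \<Delta>)))"
      by (rule sine_samples_four_term)
    also have "\<dots> = (U_mat \<phi> \<Delta> (int \<sigma>) n * L_mat \<phi> \<Delta> \<tau> n * A_mat \<alpha> n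
          * transpose_mat (W_mat \<phi> \<Delta> (int \<sigma>) n)) $$ (k, l)"
      \<comment> \<open>Multiplying by a diagonal matrix on the right only scales columns, so the
        product with the transpose of \<open>W_mat\<close> contributes the only sum.\<close>
      using kl by (simp add: U_mat_def L_mat_def A_mat_def W_mat_def mat_diag_mult_right[of _ n n]
          scalar_prod_def lessThan_atLeast0 mult.assoc)
    finally show ?thesis .
  qed
  then show ?thesis
    \<comment> \<open>Besides the entries, the dimensions must agree; those of the product come from
      its outer factors.\<close>
    by (intro eq_matI)
      (simp_all add: B_mat_def hankel_mat_def toeplitz_mat_def U_mat_def W_mat_def)
qed

end
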